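(* Let $a\geq 1$ be an integer. Then there is a finite group $G$ such that $d'(G)=\frac{a}{a+1}$.
   Context: All groups are finite. For a finite group $G$, $L(G)$ denotes the set (lattice) of all subgroups of $G$, $k'(G)$ the number of conjugacy classes of subgroups of $G$, and $d'(G)=\frac{k'(G)}{|L(G)|}$. *)

theory Defs
  imports Complex_Main "HOL-Algebra.Group_Action"
begin

definition subgroups_of :: "('a, 'b) monoid_scheme \<Rightarrow> 'a set set"
  where "subgroups_of G = {H. subgroup H G}"

text \<open>The conjugacy classes of subgroups are the orbits of the conjugation action of
  \<open>G\<close> on its subgroups; the action is written exactly as in the library theorem
  \<open>action_by_conjugation_on_subgroups_set\<close>.\<close>

definition subgroup_conjugacy_classes :: "('a, 'b) monoid_scheme \<Rightarrow> 'a set set set"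
  where "subgroup_conjugacy_classes G =
    orbits G (subgroups_of G)
      (\<lambda>g. \<lambda>H \<in> subgroups_of G. g <#\<^bsub>G\<^esub> H #>\<^bsub>G\<^esub> (inv\<^bsub>G\<^esub> g))"

text \<open>\<open>k'(G)\<close> and \<open>d'(G)\<close>. Both are meant for finite \<open>G\<close> only, as \<open>card\<close> is 0 on infinite sets.\<close>

definition num_subgroup_classes :: "('a, 'b) monoid_scheme \<Rightarrow> nat"
  where "num_subgroup_classes G = card (subgroup_conjugacy_classes G)"

definition subgroup_class_ratio :: "('a, 'b) monoid_scheme \<Rightarrow> real"
  where "subgroup_class_ratio G =
    real (num_subgroup_classes G) / real (card (subgroups_of G))"

end

(* Let G be the semidirect product of Z_5 by Z_(2^n), n = 2 * a - 1, where a generator of Z_(2^n)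
   acts on Z_5 by inversion. Its subgroups that are normal are Z_5 x Z_(2^i) and Z_(2^i) for
   i < n, and G itself: 2 * n + 1 of them. The others are the 5 Sylow 2-subgroups, which form one
   class. Hence d'(G) = (2 * n + 2) / (2 * n + 6) = 4 * a / (4 * a + 4). *)

theory Submission
  imports Defs "HOL-Number_Theory.Number_Theory"
begin

section \<open>Parity and residues modulo 5\<close>

lemma even_mod_iff:
  fixes m :: nat
  assumes "even m"
  shows "even (x mod m) \<longleftrightarrow> even x"
  using assms by (simp add: dvd_mod_iff)

text \<open>Turns a claim about residues modulo 5 into finitely many numerical cases for the
  simplifier.\<close>

lemma less_5_iff:
  fixes a :: nat
  shows "a < 5 \<longleftrightarrow> a = 0 \<or> a = 1 \<or> a = 2 \<or> a = 3 \<or> a = 4"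
  by linarith

lemma add_mult_mod_5:
  fixes x y :: nat
  shows "(x + k * y) mod 5 = (x mod 5 + k * (y mod 5)) mod 5"
  by (intro mod_add_cong mod_mult_cong) simp_all

text \<open>Since 4 is -1 modulo 5, \<open>x + 4 * y\<close> plays the part of \<open>x - y\<close>
  without subtraction on naturals.\<close>

lemma five_dvd_add_4_mult_iff:
  fixes x y :: nat
  shows "5 dvd x + 4 * y \<longleftrightarrow> x mod 5 = y mod 5"
proof -
  have "x mod 5 < 5" "y mod 5 < 5" by simp_all
  then show ?thesis
    unfolding dvd_eq_mod_eq_0 add_mult_mod_5[of x 4] less_5_iff by auto
qed

lemma ten_dvd_iff:
  fixes y :: nat
  shows "10 dvd y \<longleftrightarrow> even y \<and> 5 dvd y"
  using divides_mult[of 2 y 5] by (auto intro: dvd_trans)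

text \<open>
  By the Chinese remainder theorem the set \<open>Z\<^sub>5 \<times> Z\<^bsub>2^n\<^esub>\<close> is
  identified with \<open>{..<M}\<close>, \<open>M = 5 * 2 ^ n\<close>. The unit \<open>c\<close> is \<open>-1\<close> modulo 5 and
  \<open>1\<close> modulo \<open>2 ^ n\<close>, so an element acts as \<open>1\<close> or \<open>c\<close> according to its parity.
\<close>

locale inversion_group =
  fixes n c :: nat
  assumes n_pos: "1 \<le> n"
    and c_mod_two_power: "[c = 1] (mod 2 ^ n)"
    and c_mod_5: "[c = 4] (mod 5)"
begin

definition M :: nat where "M = 5 * 2 ^ n"

definition s :: "nat \<Rightarrow> nat" where "s x = (if even x then 1 else c)"

definition G :: "nat monoid" where
  "G = \<lparr>carrier = {..<M}, monoid.mult = (\<lambda>x y. (x + s x * y) mod M), one = 0\<rparr>"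

text \<open>The normal subgroups are the \<open>multiples d\<close> with \<open>d \<in> D\<close>,
  the Sylow 2-subgroups are the \<open>K r\<close> with \<open>r < 5\<close>.\<close>

definition multiples :: "nat \<Rightarrow> nat set" where "multiples d = {x. x < M \<and> d dvd x}"

definition K :: "nat \<Rightarrow> nat set" where
  "K r = {x. x < M \<and> (if even x then 5 dvd x else x mod 5 = r)}"

definition D :: "nat set" where "D = {d. d dvd M \<and> (even d \<or> d = 1)}"

section \<open>Arithmetic modulo \<open>M\<close> and the group axioms\<close>

lemma carrier_G [simp]: "carrier G = {..<M}"
  and mult_G [simp]: "x \<otimes>\<^bsub>G\<^esub> y = (x + s x * y) mod M"
  and one_G [simp]: "\<one>\<^bsub>G\<^esub> = 0"
  by (simp_all add: G_def)

lemma even_M [simp]: "even M" and five_dvd_M [simp]: "5 dvd M" and ten_le_M: "10 \<le> M"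
  and M_pos [simp]: "0 < M"
proof -
  obtain k where "n = Suc k" using n_pos by (cases n) auto
  then have "(5::nat) * 2 ^ n = 10 * 2 ^ k" by simp
  then have "M = 10 * 2 ^ k" unfolding M_def .
  moreover have "(1::nat) \<le> 2 ^ k" by simp
  ultimately show "even M" "5 dvd M" "10 \<le> M" "0 < M" by auto
qed

lemma M_neq_0 [simp]: "M \<noteq> 0"
  using M_pos by simp

lemma mod_M_mod_5 [simp]: "x mod M mod 5 = x mod 5"
  by (simp add: mod_mod_cancel)

lemma even_mod_M [simp]: "even (x mod M) \<longleftrightarrow> even x"
  by (simp add: even_mod_iff)

lemma five_dvd_mod_M [simp]: "5 dvd x mod M \<longleftrightarrow> 5 dvd x"
  by (simp add: dvd_mod_iff)

lemma odd_c [simp]: "odd c"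
proof -
  have "[c = 1] (mod 2)"
    by (rule cong_dvd_modulus_nat[OF c_mod_two_power]) (use n_pos in \<open>simp add: dvd_power\<close>)
  then show ?thesis by (simp add: cong_def odd_iff_mod_2_eq_one)
qed

lemma odd_s [simp]: "odd (s x)"
  by (simp add: s_def)

lemma s_mod_M [simp]: "s (x mod M) = s x"
  by (simp add: s_def)

lemma cong_M: "[x = y] (mod 5) \<Longrightarrow> [x = y] (mod 2 ^ n) \<Longrightarrow> [x = y] (mod M)"
  unfolding M_def by (rule coprime_cong_mult_nat) auto

text \<open>\<open>c\<close> is -1 modulo 5 and 1 modulo \<open>2 ^ n\<close>, so its square is 1
  modulo both coprime factors of \<open>M\<close>.\<close>

lemma c_square: "[c * c = 1] (mod M)"
proof (rule cong_M)
  show "[c * c = 1] (mod 5)" using cong_mult[OF c_mod_5 c_mod_5] by (simp add: cong_def)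
  show "[c * c = 1] (mod 2 ^ n)" using cong_mult[OF c_mod_two_power c_mod_two_power] by simp
qed

text \<open>Parity is additive and \<open>c\<close> squares to 1, so \<open>s\<close> is a
  homomorphism into the units modulo \<open>M\<close>. Associativity rests on this.\<close>

lemma s_add: "[s (x + y) = s x * s y] (mod M)"
  using cong_sym[OF c_square] by (auto simp: s_def)

text \<open>Here and below \<open>M - 1\<close> stands for -1 modulo \<open>M\<close>, so this is
  the residue of \<open>- s x * x\<close>.\<close>

definition inverse_of :: "nat \<Rightarrow> nat" where "inverse_of x = ((M - 1) * s x * x) mod M"

lemma odd_M_minus_1 [simp]: "odd (M - 1)"
  using M_pos by (metis even_M even_Suc Suc_pred')

lemma M_minus_1_add: "[(M - 1) * x + x = 0] (mod M)"
proof -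
  have "(M - 1) * x + x = M * x" using M_pos by (cases M) auto
  then show ?thesis by (simp add: cong_def)
qed

lemma inverse_of_mult: "inverse_of x \<otimes>\<^bsub>G\<^esub> x = 0"
proof -
  have "s (inverse_of x) = s x" by (simp add: inverse_of_def) (simp add: s_def)
  moreover have "[inverse_of x + s x * x = (M - 1) * (s x * x) + s x * x] (mod M)"
    by (simp add: inverse_of_def cong_def mod_add_left_eq mult.assoc)
  then have "[inverse_of x + s x * x = 0] (mod M)"
    using M_minus_1_add cong_trans by blast
  ultimately show ?thesis by (simp add: cong_def)
qed

lemma inverse_of_less: "inverse_of x < M"
  by (simp add: inverse_of_def)

lemma group_G: "group G"
proof (rule groupI)
  fix x y z
  \<comment> \<open>\<open>s\<close> sees only parity, and the odd factor \<open>s x\<close> does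
    not change the parity of \<open>y\<close>.\<close>
  have par: "s (x + s x * y) = s (x + y)" by (simp add: s_def)
  have "[x + s x * y + s (x + y) * z = x + s x * y + s x * s y * z] (mod M)"
    by (intro cong_add cong_mult s_add cong_refl)
  moreover have "[x + s x * (y + s y * z) = x + s x * ((y + s y * z) mod M)] (mod M)"
    by (intro cong_add cong_mult cong_refl) (simp add: cong_def)
  ultimately have "[x + s x * y + s (x + y) * z = x + s x * ((y + s y * z) mod M)] (mod M)"
    by (simp add: cong_def algebra_simps)
  then show "x \<otimes>\<^bsub>G\<^esub> y \<otimes>\<^bsub>G\<^esub> z = x \<otimes>\<^bsub>G\<^esub> (y \<otimes>\<^bsub>G\<^esub> z)"
    by (simp add: par cong_def mod_add_left_eq)
next
  fix x assume "x \<in> carrier G"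
  then show "\<one>\<^bsub>G\<^esub> \<otimes>\<^bsub>G\<^esub> x = x" by (simp add: s_def)
  show "\<exists>y\<in>carrier G. y \<otimes>\<^bsub>G\<^esub> x = \<one>\<^bsub>G\<^esub>"
    using inverse_of_mult inverse_of_less by (metis carrier_G lessThan_iff one_G)
qed auto

lemma inv_G: "x < M \<Longrightarrow> inv\<^bsub>G\<^esub> x = inverse_of x"
  using group.inv_equality[OF group_G, of "inverse_of x" x] inverse_of_mult inverse_of_less
  by simp

section \<open>Residues modulo 5; the listed sets are subgroups\<close>

lemma s_mod_5: "[s x = (if even x then 1 else 4)] (mod 5)"
  using c_mod_5 by (simp add: s_def)

lemma mult_mod_5: "x \<otimes>\<^bsub>G\<^esub> y mod 5 = (x + (if even x then 1 else 4) * y) mod 5"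
proof -
  have "[x + s x * y = x + (if even x then 1 else 4) * y] (mod 5)"
    by (intro cong_add cong_mult s_mod_5 cong_refl)
  then show ?thesis by (simp add: cong_def)
qed

lemma M_minus_1_mod_5: "[M - 1 = 4] (mod 5)"
proof -
  obtain k :: nat where "2 ^ n = Suc k" using not0_implies_Suc[of "2 ^ n"] by auto
  then have "M - 1 = 4 + 5 * k" by (simp add: M_def)
  then show ?thesis by (simp add: cong_def)
qed

lemma inverse_of_mod_5: "inverse_of x mod 5 = (4 * (if even x then 1 else 4) * x) mod 5"
proof -
  have "[(M - 1) * s x * x = 4 * (if even x then 1 else 4) * x] (mod 5)"
    by (intro cong_mult s_mod_5 cong_refl M_minus_1_mod_5)
  then show ?thesis unfolding cong_def inverse_of_def mod_M_mod_5 .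
qed

lemma subgroup_multiples:
  assumes "d dvd M"
  shows "subgroup (multiples d) G"
proof (rule group.subgroupI[OF group_G])
  show "multiples d \<noteq> {}" using M_pos by (force simp: multiples_def)
  show "inv\<^bsub>G\<^esub> x \<in> multiples d" if "x \<in> multiples d" for x
    using that assms by (auto simp: multiples_def inv_G inverse_of_def dvd_mod_iff)
qed (use assms in \<open>auto simp: multiples_def dvd_mod_iff\<close>)

text \<open>Residue modulo 5 together with parity maps \<open>G\<close> onto the dihedral group of
  order 10. \<open>K r\<close> is the preimage of the subgroup of order 2 generated by the
  reflection with residue \<open>r\<close>.\<close>

lemma subgroup_K:
  assumes "r < 5"
  shows "subgroup (K r) G"
proof (rule group.subgroupI[OF group_G])
  show "K r \<noteq> {}" using M_pos by (force simp: K_def)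
  show "inv\<^bsub>G\<^esub> x \<in> K r" if x: "x \<in> K r" for x
  proof -
    have "even (inverse_of x) \<longleftrightarrow> even x" by (simp add: inverse_of_def)
    moreover have "x < M" and xr: "x mod 5 = (if even x then 0 else r)"
      using x by (auto simp: K_def split: if_splits)
    \<comment> \<open>Even members have residue 0; an odd element is its own inverse modulo 5, as
      \<open>4 * 4\<close> is 1 there.\<close>
    have "inverse_of x mod 5 = x mod 5"
    proof (cases "even x")
      case True
      have "4 * 1 * x mod 5 = x mod 5" if "x mod 5 = 0"
        using that by (simp flip: dvd_eq_mod_eq_0)
      then show ?thesis using True xr by (simp only: inverse_of_mod_5 if_True)
    next
      case False
      have "4 * 4 * x = x + 5 * (3 * x)" by simp
      then have "4 * 4 * x mod 5 = x mod 5" by (metis mod_mult_self2)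
      then show ?thesis using False by (simp only: inverse_of_mod_5 if_False)
    qed
    ultimately show ?thesis using \<open>x < M\<close> xr
      by (cases "even x") (simp_all add: K_def inv_G inverse_of_less dvd_eq_mod_eq_0)
  qed
  show "x \<otimes>\<^bsub>G\<^esub> y \<in> K r" if x: "x \<in> K r" and y: "y \<in> K r" for x y
  proof -
    have xr: "x mod 5 = (if even x then 0 else r)" and yr: "y mod 5 = (if even y then 0 else r)"
      using x y by (auto simp: K_def split: if_splits)
    \<comment> \<open>An even \<open>x\<close> adds 0 to the residue of \<open>y\<close>; an odd
      \<open>x\<close> gives \<open>r - 0\<close> or \<open>r - r\<close>.\<close>
    have "(x + (if even x then 1 else 4) * y) mod 5 = (if even x \<longleftrightarrow> even y then 0 else r)"
    proof -
      have "(x + 1 * y) mod 5 = (if even y then 0 else r)" if "x mod 5 = 0"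
        using that yr assms by (simp only: add_mult_mod_5[of x 1]) simp
      moreover have "(x + 4 * y) mod 5 = (if even y then r else 0)" if "x mod 5 = r"
        unfolding add_mult_mod_5[of x 4] that yr using assms by (auto simp: less_5_iff)
      ultimately show ?thesis using xr by auto
    qed
    then have "x \<otimes>\<^bsub>G\<^esub> y mod 5 = (if even x \<longleftrightarrow> even y then 0 else r)"
      by (simp only: mult_mod_5)
    moreover have "even (x \<otimes>\<^bsub>G\<^esub> y) \<longleftrightarrow> (even x \<longleftrightarrow> even y)" by simp
    moreover have "x \<otimes>\<^bsub>G\<^esub> y < M" by simp
    ultimately show ?thesis unfolding K_def
      by (auto simp only: mem_Collect_eq dvd_eq_mod_eq_0 split: if_splits)
  qed
qed (auto simp: K_def)

section \<open>Every subgroup is one of the listed ones\<close>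

text \<open>Multiplication by an even element on the left is addition modulo \<open>M\<close>.
  Reducing inside the membership allows arbitrary representatives \<open>x\<close> and
  \<open>y\<close>.\<close>

lemma even_add_mem:
  assumes "subgroup H G" "even x" "x mod M \<in> H" "y mod M \<in> H"
  shows "(x + y) mod M \<in> H"
  using subgroup.m_closed[OF assms(1,3,4)] assms(2) by (simp add: s_def mod_add_eq)

lemma even_mult_mem:
  assumes "subgroup H G" "even x" "x mod M \<in> H"
  shows "(k * x) mod M \<in> H"
proof (induction k)
  case 0
  then show ?case using subgroup.one_closed[OF assms(1)] by simp
next
  case (Suc k)
  then show ?case using even_add_mem[OF assms(1,2,3), of "k * x"] by simp
qed

text \<open>On even elements the operation is addition, so \<open>H\<close> is an additive subgroup
  of the integers modulo \<open>M\<close> and hence cyclic.\<close>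

lemma even_subgroup_cases:
  assumes H: "subgroup H G" and ev: "\<And>x. x \<in> H \<Longrightarrow> even x"
  obtains d where "d dvd M" "even d" "H = multiples d"
proof -
  define S where "S = {x. x mod M \<in> H}"
  have evS: "even x" if "x \<in> S" for x using ev that by (force simp: S_def)
  have add: "x + y \<in> S" if "x \<in> S" "y \<in> S" for x y
    using that even_add_mem[OF H evS] by (auto simp: S_def)
  have mult: "k * x \<in> S" if "x \<in> S" for x k
    using that even_mult_mem[OF H evS] by (auto simp: S_def)
  have MS: "M \<in> S" using subgroup.one_closed[OF H] by (simp add: S_def)
  \<comment> \<open>The generator is the least positive representative of a member;
    \<open>M\<close>, representing 0, shows that one exists and is later seen to be a multiple of
    \<open>d\<close>.\<close>
  define d where "d = (LEAST d. 0 < d \<and> d \<in> S)"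
  have d: "0 < d" "d \<in> S"
    using LeastI[of "\<lambda>d. 0 < d \<and> d \<in> S" M] MS by (auto simp: d_def)
  have dvd: "d dvd x" if x: "x \<in> S" for x
  proof -
    \<comment> \<open>Division with remainder: modulo \<open>M\<close> this is
      \<open>x - x div d * d\<close>, the remainder of \<open>x\<close>.\<close>
    have "x + (M - 1) * (x div d * d) \<in> S" by (intro add mult x d)
    moreover have "[x + (M - 1) * (x div d * d) = x mod d] (mod M)"
    proof -
      have "x + (M - 1) * (x div d * d) = x mod d + ((M - 1) * (x div d * d) + x div d * d)"
        using mod_div_mult_eq[of x d] by linarith
      then show ?thesis
        using cong_add[OF cong_refl M_minus_1_add, of "x mod d" "x div d * d"] by simp
    qed
    ultimately have "x mod d \<in> S" by (simp add: S_def cong_def)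
    moreover have "x mod d < d" using d by simp
    ultimately have "x mod d = 0"
      using not_less_Least[of "x mod d" "\<lambda>d. 0 < d \<and> d \<in> S"] d_def by auto
    then show ?thesis by auto
  qed
  have "H = multiples d"
  proof
    show "H \<subseteq> multiples d"
    proof
      fix x assume "x \<in> H"
      moreover from this have "x < M" using subgroup.subset[OF H] by auto
      ultimately show "x \<in> multiples d" using dvd by (auto simp: multiples_def S_def)
    qed
    show "multiples d \<subseteq> H"
    proof
      fix x assume "x \<in> multiples d"
      then have "x = x div d * d" "x < M" by (auto simp: multiples_def)
      then show "x \<in> H" using mult[OF d(2), of "x div d"] by (simp add: S_def)
    qed
  qed
  then show ?thesis using that dvd[OF MS] evS[OF d(2)] by blast
qed

text \<open>The square of an odd \<open>x\<close> is \<open>(1 + c) * x\<close>, which is 0 modulo 5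
  and \<open>2 * x\<close> modulo \<open>2 ^ n\<close>. As \<open>x\<close> is a unit modulo
  \<open>2 ^ n\<close>, the multiples of this square give all multiples of 10.\<close>

lemma multiples_of_10_mem:
  assumes H: "subgroup H G" and x: "x \<in> H" "odd x" and z: "10 dvd z"
  shows "z mod M \<in> H"
proof -
  obtain w where w: "z = 10 * w" using z by blast
  define e where "e = (1 + c) * x"
  have "x \<otimes>\<^bsub>G\<^esub> x \<in> H" using subgroup.m_closed[OF H x(1) x(1)] .
  then have eH: "e mod M \<in> H" using x by (simp add: e_def s_def algebra_simps)
  have "coprime x (2 ^ n)" using x(2) by (simp add: coprime_commute)
  \<comment> \<open>Chosen so that \<open>k * e\<close> is \<open>2 * (x * k)\<close>, that is
    \<open>10 * w\<close>, modulo \<open>2 ^ n\<close>.\<close>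
  then obtain k where k: "[x * k = 5 * w] (mod 2 ^ n)" using cong_solve by blast
  have "[k * e = z] (mod M)"
  proof (rule cong_M)
    have "[1 + c = 1 + 4] (mod 5)"
      by (intro cong_add cong_refl c_mod_5)
    then have "5 dvd 1 + c" by (simp add: cong_def dvd_eq_mod_eq_0)
    then have "5 dvd k * e" unfolding e_def by (intro dvd_mult dvd_mult2)
    moreover have "5 dvd z" using z by (simp add: ten_dvd_iff)
    ultimately show "[k * e = z] (mod 5)" by (simp add: cong_def dvd_eq_mod_eq_0)
    have "[(1 + c) * (x * k) = (1 + 1) * (5 * w)] (mod 2 ^ n)"
      by (intro cong_mult cong_add cong_refl c_mod_two_power k)
    then show "[k * e = z] (mod 2 ^ n)" by (simp add: w e_def algebra_simps)
  qed
  then show ?thesis using even_mult_mem[OF H _ eH, of k] by (simp add: cong_def e_def)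
qed

text \<open>For odd \<open>x\<close> and \<open>y\<close> the quotient of \<open>y\<close> by
  \<open>x\<close> in \<open>G\<close> is \<open>y - x\<close> modulo \<open>M\<close>, because
  \<open>c * c\<close> is 1. It is even, so the odd members of \<open>H\<close> are determined by
  the even ones and \<open>x\<close>.\<close>

lemma odd_mem_iff:
  assumes H: "subgroup H G" and x: "x \<in> H" "odd x" and y: "odd y" "y < M"
  shows "y \<in> H \<longleftrightarrow> (y + (M - 1) * x) mod M \<in> H"
proof -
  let ?z = "(y + (M - 1) * x) mod M"
  interpret group G by (rule group_G)
  have xM: "x < M" using subgroup.subset[OF H] x by auto
  have "[?z + x = y + ((M - 1) * x + x)] (mod M)"
    by (simp add: cong_def mod_add_left_eq add.assoc)
  then have "[?z + x = y] (mod M)"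
    using cong_add[OF cong_refl M_minus_1_add, of y x] cong_trans by fastforce
  moreover have "even ?z" using x y by simp
  ultimately have eq: "?z \<otimes>\<^bsub>G\<^esub> x = y" using y by (simp add: s_def cong_def del: even_mod_M)
  show ?thesis
  proof
    assume "?z \<in> H"
    then show "y \<in> H" using subgroup.m_closed[OF H _ x(1)] eq by metis
  next
    assume "y \<in> H"
    moreover have "?z = y \<otimes>\<^bsub>G\<^esub> inv\<^bsub>G\<^esub> x"
      using inv_solve_right[of ?z y x] xM y eq by simp
    ultimately show "?z \<in> H"
      using subgroup.m_closed[OF H] subgroup.m_inv_closed[OF H x(1)] by metis
  qed
qed

text \<open>\<open>H\<close> contains all multiples of 10. An even member not divisible by 5 then
  yields every even element, so \<open>H\<close> is everything. Otherwise the even members are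
  exactly the multiples of 10, and the odd ones are those congruent to \<open>x\<close> modulo
  5.\<close>

lemma odd_subgroup_cases:
  assumes H: "subgroup H G" and x: "x \<in> H" "odd x"
  shows "H = multiples 1 \<or> H = K (x mod 5)"
proof (cases "\<exists>w\<in>H. even w \<and> \<not> 5 dvd w")
  case True
  then obtain w where w: "w \<in> H" "even w" "\<not> 5 dvd w" by blast
  have sub: "H \<subseteq> {..<M}" using subgroup.subset[OF H] by simp
  have even_mem: "z mod M \<in> H" if z: "even z" for z
  proof -
    have "coprime w 5"
      using w(3) prime_imp_coprime_nat[of 5 w] by (simp add: coprime_commute)
    then obtain k where k: "[w * k = z] (mod 5)" using cong_solve by blast
    \<comment> \<open>Modulo 5, \<open>t\<close> is \<open>z - w * k\<close>, hence 0. It remains to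
      write \<open>- 4 * (k * w)\<close> modulo \<open>M\<close> as a member of
      \<open>H\<close>.\<close>
    define t where "t = z + 4 * (w * k)"
    have "5 dvd t" using k by (simp add: t_def cong_def five_dvd_add_4_mult_iff)
    moreover have "even t" using z w by (simp add: t_def)
    ultimately have "10 dvd t" by (simp add: ten_dvd_iff)
    then have tH: "t mod M \<in> H" using multiples_of_10_mem[OF H x] by blast
    have "(k * w) mod M \<in> H" using even_mult_mem[OF H w(2), of k] w sub by auto
    \<comment> \<open>Splits \<open>- 4 * (k * w)\<close> as \<open>k * w - 5 * (k * w)\<close>; the
      second term is a multiple of 10 because \<open>w\<close> is even.\<close>
    moreover have "10 dvd 5 * (M - 1) * (k * w)"
    proof -
      have "(5::nat) * 2 dvd (5 * (M - 1)) * (k * w)"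
        using w(2) by (intro mult_dvd_mono) simp_all
      then show ?thesis by simp
    qed
    then have "(5 * (M - 1) * (k * w)) mod M \<in> H"
      using multiples_of_10_mem[OF H x] by blast
    ultimately have "(k * w + 5 * (M - 1) * (k * w)) mod M \<in> H"
      using even_add_mem[OF H] w(2) by simp
    then have "(t + (k * w + 5 * (M - 1) * (k * w))) mod M \<in> H"
      using even_add_mem[OF H \<open>even t\<close> tH] by blast
    moreover have "[t + (k * w + 5 * (M - 1) * (k * w)) = z] (mod M)"
    proof -
      have "t + (k * w + 5 * (M - 1) * (k * w)) = z + 5 * ((M - 1) * (k * w) + k * w)"
        by (simp add: t_def algebra_simps)
      then show ?thesis
        using cong_add[OF cong_refl cong_mult[OF cong_refl M_minus_1_add], of z 5 "k * w"]
        by (simp only: mult_0_right add_0_right)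
    qed
    ultimately show ?thesis by (simp add: cong_def)
  qed
  have "y \<in> H" if "y < M" for y
    using that even_mem[of y] even_mem[of "y + (M - 1) * x"] odd_mem_iff[OF H x, of y] x
    by (cases "even y") auto
  then have "H = multiples 1" using sub by (auto simp: multiples_def)
  then show ?thesis ..
next
  case False
  have sub: "y < M" if "y \<in> H" for y using subgroup.subset[OF H] that by auto
  have m5: "y mod 5 = x mod 5 \<longleftrightarrow> 5 dvd (y + (M - 1) * x)" for y
  proof -
    have "[y + (M - 1) * x = y + 4 * x] (mod 5)"
      by (intro cong_add cong_mult cong_refl M_minus_1_mod_5)
    then have "5 dvd (y + (M - 1) * x) \<longleftrightarrow> 5 dvd y + 4 * x"
      by (simp add: cong_def dvd_eq_mod_eq_0)
    then show ?thesis by (simp add: five_dvd_add_4_mult_iff)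
  qed
  have ev: "y \<in> H \<longleftrightarrow> 5 dvd y" if "even y" "y < M" for y
  proof
    show "5 dvd y" if "y \<in> H" using False that \<open>even y\<close> by blast
    show "y \<in> H" if "5 dvd y"
    proof -
      have "10 dvd y" using \<open>even y\<close> that by (simp add: ten_dvd_iff)
      then show ?thesis using multiples_of_10_mem[OF H x] \<open>y < M\<close> by fastforce
    qed
  qed
  have od: "y \<in> H \<longleftrightarrow> y mod 5 = x mod 5" if y: "odd y" "y < M" for y
  proof -
    have "even (y + (M - 1) * x)" using x y by simp
    then show ?thesis using odd_mem_iff[OF H x y] ev[of "(y + (M - 1) * x) mod M"] m5 by simp
  qed
  have "H = K (x mod 5)"
    using ev od sub by (auto simp: K_def)
  then show ?thesis ..
qed

lemma subgroups_eq: "subgroups_of G = multiples ` D \<union> K ` {..<5}"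
proof
  show "subgroups_of G \<subseteq> multiples ` D \<union> K ` {..<5}"
  proof
    fix H assume "H \<in> subgroups_of G"
    then have H: "subgroup H G" by (simp add: subgroups_of_def)
    show "H \<in> multiples ` D \<union> K ` {..<5}"
    proof (cases "\<exists>x\<in>H. odd x")
      case True
      then obtain x where "x \<in> H" "odd x" by blast
      from odd_subgroup_cases[OF H this] show ?thesis
        by (auto simp: D_def)
    next
      case False
      then show ?thesis using even_subgroup_cases[OF H] by (auto simp: D_def) blast
    qed
  qed
  show "multiples ` D \<union> K ` {..<5} \<subseteq> subgroups_of G"
  proof (intro Un_least image_subsetI)
    show "multiples d \<in> subgroups_of G" if "d \<in> D" for d
      using that subgroup_multiples[of d] by (simp add: subgroups_of_def D_def)
    show "K r \<in> subgroups_of G" if "r \<in> {..<5}" for r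
      using that subgroup_K[of r] by (simp add: subgroups_of_def)
  qed
qed

section \<open>Counting the subgroups\<close>

lemma inj_multiples: "inj_on multiples D"
proof (rule inj_onI)
  have dvd: "d dvd d'" if "d dvd M" "d' dvd M" "multiples d = multiples d'" for d d'
  proof -
    \<comment> \<open>The reduction matters only for \<open>d' = M\<close>, which is represented by
      0.\<close>
    have "d' mod M \<in> multiples d'" using that by (simp add: multiples_def dvd_mod_iff)
    then have "d' mod M \<in> multiples d" using that by simp
    then show ?thesis using that by (simp add: multiples_def dvd_mod_iff)
  qed
  fix d d' assume "d \<in> D" "d' \<in> D" "multiples d = multiples d'"
  then show "d = d'" using dvd[of d d'] dvd[of d' d] by (auto simp: D_def intro: dvd_antisym)
qed

lemma odd_mem_K:
  assumes "r < 5"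
  obtains x where "odd x" "x \<in> K r" "x mod 5 = r"
proof -
  \<comment> \<open>Both candidates lie below 10, hence below \<open>M\<close>.\<close>
  define x where "x = (if odd r then r else r + 5)"
  have "odd x" "x mod 5 = r" "x < M" using assms ten_le_M by (auto simp: x_def)
  then show ?thesis using that by (simp add: K_def)
qed

lemma K_subset_K:
  assumes "r < 5" "K r \<subseteq> K t"
  shows "r = t"
proof -
  obtain x where x: "odd x" "x \<in> K r" "x mod 5 = r" using odd_mem_K[OF assms(1)] .
  then have "x \<in> K t" using assms(2) by blast
  then show ?thesis using x(1,3) by (simp add: K_def)
qed

lemma inj_K: "inj_on K {..<5}"
proof (rule inj_onI)
  show "r = t" if "r \<in> {..<5}" "K r = K t" for r t
    using that K_subset_K[of r t] by simp
qed

text \<open>\<open>K r\<close> has odd members but misses 2. The odd divisor 5 of \<open>M\<close>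
  has to be absent from \<open>D\<close>, since \<open>multiples 5\<close> is
  \<open>K 0\<close>.\<close>

lemma multiples_neq_K:
  assumes "d \<in> D" "r < 5"
  shows "multiples d \<noteq> K r"
proof
  assume eq: "multiples d = K r"
  obtain x where "odd x" "x \<in> K r" using odd_mem_K[OF assms(2)] .
  then have "odd x" "d dvd x" using eq by (auto simp: multiples_def)
  then have "d = 1" using assms(1) dvd_trans by (auto simp: D_def)
  then have "2 \<in> K r" using ten_le_M by (simp flip: eq add: multiples_def)
  then show False by (simp add: K_def)
qed

lemma card_D: "card D = 2 * n + 1"
proof -
  \<comment> \<open>The exponents run from 1 to \<open>n\<close>, which leaves out the odd divisors
    1 and 5; only 1 is put back.\<close>
  let ?A = "(\<lambda>i. 2 ^ Suc i :: nat) ` {..<n}" and ?B = "(\<lambda>i. 5 * 2 ^ Suc i :: nat) ` {..<n}"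
  have "D = insert 1 (?A \<union> ?B)"
  proof
    show "D \<subseteq> insert 1 (?A \<union> ?B)"
    proof
      fix d assume "d \<in> D"
      then have d: "d dvd 5 * 2 ^ n" "even d \<or> d = 1" by (auto simp: D_def M_def)
      show "d \<in> insert 1 (?A \<union> ?B)"
      proof (cases "d = 1")
        case False
        then have "even d" using d by blast
        obtain b e where be: "d = b * e" "b dvd 5" "e dvd 2 ^ n"
          using division_decomp[OF d(1)] by blast
        have "b < 5 \<or> b = 5" using dvd_imp_le[OF be(2)] by auto
        then have b: "b = 1 \<or> b = 5" using be(2) unfolding less_5_iff by auto
        obtain i where i: "i \<le> n" "e = 2 ^ i"
          using be(3) divides_primepow_nat[OF two_is_prime_nat] by blast
        have "i \<noteq> 0" using \<open>even d\<close> b be(1) i by (cases i) auto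
        then obtain j where "i = Suc j" by (cases i) auto
        then show ?thesis using b be(1) i by auto
      qed simp
    qed
    have "(2::nat) ^ Suc i dvd 5 * 2 ^ n" "(5::nat) * 2 ^ Suc i dvd 5 * 2 ^ n" if "i < n" for i
      using that le_imp_power_dvd[of "Suc i" n "2::nat"] by (simp_all only: dvd_mult mult_dvd_mono Suc_leI dvd_refl)
    then show "insert 1 (?A \<union> ?B) \<subseteq> D" by (auto simp: D_def M_def)
  qed
  moreover have "card ?A = n" by (subst card_image) (auto intro!: inj_onI)
  moreover have "card ?B = n" by (subst card_image) (auto intro!: inj_onI)
  moreover have "?A \<inter> ?B = {}"
  proof -
    have "\<not> (5::nat) dvd 2 ^ k" for k using prime_dvd_power[of "5::nat" 2 k] by auto
    then have "(2::nat) ^ Suc i \<noteq> 5 * 2 ^ Suc j" for i j by (metis dvd_triv_left)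
    then show ?thesis by blast
  qed
  moreover have "1 \<notin> ?A \<union> ?B" by auto
  ultimately show ?thesis by (simp add: card_Un_disjoint)
qed

lemma finite_D: "finite D"
  using card_D card.infinite by fastforce

lemma card_subgroups: "card (subgroups_of G) = 2 * n + 6"
proof -
  have "multiples ` D \<inter> K ` {..<5} = {}" using multiples_neq_K by auto
  then show ?thesis
    unfolding subgroups_eq
    by (simp add: card_Un_disjoint finite_D card_image inj_multiples inj_K card_D)
qed

section \<open>Conjugation of subgroups and its orbits\<close>

definition conj_action :: "nat \<Rightarrow> nat set \<Rightarrow> nat set" where
  "conj_action g = (\<lambda>H \<in> subgroups_of G. g <#\<^bsub>G\<^esub> H #>\<^bsub>G\<^esub> (inv\<^bsub>G\<^esub> g))"

lemma group_action_conj: "group_action G (subgroups_of G) conj_action"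
  unfolding conj_action_def subgroups_of_def
  by (rule group.action_by_conjugation_on_subgroups_set[OF group_G])

lemma conj_action_subgroup:
  assumes "subgroup H G" "g < M"
  shows "subgroup (conj_action g H) G"
  using group.subgroup_conjugation_is_surj2[OF group_G _ assms(1), of g] assms
  by (simp add: conj_action_def subgroups_of_def)

text \<open>A conjugate \<open>y\<close> of \<open>x\<close> by \<open>g\<close> satisfies
  \<open>y + s y * g = g + s g * x\<close> modulo \<open>M\<close>, which avoids the inverse of
  \<open>g\<close>. For even \<open>x\<close> the two \<open>g\<close> cancel; for odd
  \<open>x\<close> the factor \<open>s y\<close> is -1 modulo 5, whence
  \<open>2 * g\<close>.\<close>

lemma conj_action_eqs:
  assumes H: "subgroup H G" and g: "g < M" and y: "y \<in> conj_action g H"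
  obtains x where "x \<in> H" "y < M" "even y \<longleftrightarrow> even x"
    "even x \<Longrightarrow> y = (s g * x) mod M" "odd x \<Longrightarrow> y mod 5 = (2 * g + s g * x) mod 5"
proof -
  interpret group G by (rule group_G)
  obtain x where x: "x \<in> H" and yx: "y = g \<otimes>\<^bsub>G\<^esub> x \<otimes>\<^bsub>G\<^esub> inv\<^bsub>G\<^esub> g"
    using y H by (auto simp: conj_action_def subgroups_of_def l_coset_def r_coset_def simp del: mult_G)
  have cl: "x \<in> carrier G" "g \<in> carrier G" using x subgroup.subset[OF H] g by auto
  then have yM: "y \<in> carrier G" and "y \<otimes>\<^bsub>G\<^esub> g = g \<otimes>\<^bsub>G\<^esub> x"
    unfolding yx by (simp_all add: m_assoc del: mult_G carrier_G one_G)
  then have eq: "[y + s y * g = g + s g * x] (mod M)" by (simp add: cong_def)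
  then have "even (y + s y * g) \<longleftrightarrow> even (g + s g * x)"
    by (metis cong_def even_mod_M)
  then have par: "even y \<longleftrightarrow> even x" by auto
  show ?thesis
  proof (rule that[OF x _ par])
    show "y < M" using yM by simp
    show "y = (s g * x) mod M" if "even x"
    proof -
      have "[y + g = s g * x + g] (mod M)" using eq par that by (simp add: s_def add.commute)
      then have "[y = s g * x] (mod M)" by (simp add: cong_add_rcancel_nat)
      then show ?thesis using yM by (simp add: cong_def)
    qed
    show "y mod 5 = (2 * g + s g * x) mod 5" if "odd x"
    proof -
      have "s y = c" using par that by (simp add: s_def)
      have "[y + s y * g = g + s g * x] (mod 5)" using eq five_dvd_M cong_dvd_modulus_nat by blast
      moreover have "[y + s y * g = y + 4 * g] (mod 5)"
        unfolding \<open>s y = c\<close> by (intro cong_add cong_mult cong_refl c_mod_5)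
      ultimately have "[y + 4 * g = g + s g * x] (mod 5)" by (meson cong_sym cong_trans)
      then have "[y + 4 * g + g = g + s g * x + g] (mod 5)"
        by (rule cong_add[OF _ cong_refl])
      moreover have "y + 4 * g + g = y + 5 * g" "g + s g * x + g = 2 * g + s g * x" by simp_all
      ultimately show ?thesis unfolding cong_def by (metis mod_mult_self2)
    qed
  qed
qed

lemma card_conj_action:
  assumes H: "subgroup H G" and g: "g < M"
  shows "card (conj_action g H) = card H"
proof -
  interpret group G by (rule group_G)
  have "conj_action g H = (\<lambda>h. g \<otimes>\<^bsub>G\<^esub> h \<otimes>\<^bsub>G\<^esub> inv\<^bsub>G\<^esub> g) ` H"
    using H by (auto simp: conj_action_def subgroups_of_def l_coset_def r_coset_def simp del: mult_G)
  moreover have "inj_on (\<lambda>h. g \<otimes>\<^bsub>G\<^esub> h \<otimes>\<^bsub>G\<^esub> inv\<^bsub>G\<^esub> g) H"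
    using conjugation_is_inj[of g] subgroup.subset[OF H] g
    by (intro inj_onI) (auto simp del: mult_G)
  ultimately show ?thesis by (simp add: card_image)
qed

text \<open>Conjugation only scales even elements by \<open>s g\<close>, so it maps
  \<open>multiples d\<close> into itself for even \<open>d\<close>; for \<open>d = 1\<close> this is
  the whole group. Equal cardinality turns the inclusion into equality.\<close>

lemma orbit_multiples:
  assumes "d \<in> D"
  shows "orbit G conj_action (multiples d) = {multiples d}"
proof -
  have d: "d dvd M" "even d \<or> d = 1" using assms by (auto simp: D_def)
  have H: "subgroup (multiples d) G" using d subgroup_multiples by blast
  have sub: "conj_action g (multiples d) \<subseteq> multiples d" if g: "g < M" for g
  proof
    fix y assume "y \<in> conj_action g (multiples d)"
    from conj_action_eqs[OF H g this] obtain x where x: "x \<in> multiples d" "y < M"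
      "even x \<Longrightarrow> y = (s g * x) mod M" by metis
    show "y \<in> multiples d"
    proof (cases "even x")
      case True
      then show ?thesis using x d by (simp add: multiples_def dvd_mod_iff)
    next
      case False
      then have "d = 1" using x d dvd_trans by (auto simp: multiples_def)
      then show ?thesis using x by (simp add: multiples_def)
    qed
  qed
  have "conj_action g (multiples d) = multiples d" if g: "g < M" for g
  proof -
    have "card (conj_action g (multiples d)) = card (multiples d)"
      using card_conj_action[OF H g] .
    then show ?thesis using sub[OF g] by (intro card_subset_eq) (auto simp: multiples_def)
  qed
  then show ?thesis using M_pos by (auto simp: orbit_def intro!: exI[of _ 0])
qed

lemma conj_action_K:
  assumes r: "r < 5" and g: "g < M"
  shows "conj_action g (K r) = K ((2 * g + s g * r) mod 5)"
proof -
  let ?t = "(2 * g + s g * r) mod 5"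
  have H: "subgroup (K r) G" using subgroup_K[OF r] .
  have sub: "conj_action g (K r) \<subseteq> K ?t"
  proof
    fix y assume "y \<in> conj_action g (K r)"
    from conj_action_eqs[OF H g this] obtain x where x: "x \<in> K r" "y < M" "even y \<longleftrightarrow> even x"
      "even x \<Longrightarrow> y = (s g * x) mod M" "odd x \<Longrightarrow> y mod 5 = (2 * g + s g * x) mod 5" by metis
    show "y \<in> K ?t"
    proof (cases "even x")
      case True
      then show ?thesis using x by (auto simp: K_def)
    next
      case False
      then have "x mod 5 = r" using x by (simp add: K_def)
      then have "[s g * x = s g * r] (mod 5)" using r by (intro cong_mult cong_refl) (simp add: cong_def)
      then have "[2 * g + s g * x = 2 * g + s g * r] (mod 5)" by (intro cong_add cong_refl)
      then show ?thesis using False x by (simp add: K_def cong_def)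
    qed
  qed
  interpret group_action G "subgroups_of G" conj_action by (rule group_action_conj)
  have conj: "conj_action g (K r) \<in> subgroups_of G" and KrG: "K r \<in> subgroups_of G"
    using conj_action_subgroup[OF H g] H by (auto simp: subgroups_of_def)
  \<comment> \<open>The conjugate is a listed subgroup. It is no \<open>multiples d\<close>, whose
    orbit is a singleton, so it is some \<open>K u\<close>, and the inclusion already shown forces
    \<open>u = ?t\<close>.\<close>
  have "conj_action g (K r) \<noteq> multiples d" if d: "d \<in> D" for d
  proof
    assume eq: "conj_action g (K r) = multiples d"
    have "conj_action g (K r) \<in> orbit G conj_action (K r)" using g by (auto simp: orbit_def)
    then have "K r \<in> orbit G conj_action (multiples d)"
      using orbit_sym[OF KrG conj] eq by simp
    then show False using orbit_multiples[OF d] multiples_neq_K[OF d r] by simp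
  qed
  then obtain u where "u < 5" "conj_action g (K r) = K u"
    using conj by (auto simp: subgroups_eq)
  then show ?thesis using sub K_subset_K by metis
qed

lemma orbit_K:
  assumes r: "r < 5"
  shows "orbit G conj_action (K r) = K ` {..<5}"
proof
  show "orbit G conj_action (K r) \<subseteq> K ` {..<5}"
    using conj_action_K[OF r] by (auto simp: orbit_def)
  show "K ` {..<5} \<subseteq> orbit G conj_action (K r)"
  proof
    fix H assume "H \<in> K ` {..<5}"
    then obtain t where t: "t < 5" "H = K t" by auto
    \<comment> \<open>An even \<open>g\<close> shifts \<open>r\<close> by \<open>2 * g\<close>.
      Since \<open>2 * 8\<close> is 1 modulo 5, this shift is \<open>t + 4 * r\<close>, that is
      \<open>t - r\<close>; reduction modulo 10 keeps parity and residue and puts \<open>g\<close>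
      below \<open>M\<close>.\<close>
    define g where "g = (8 * (t + 4 * r)) mod 10"
    have "g < M" using ten_le_M by (simp add: g_def less_le_trans)
    have "even g" by (simp add: g_def dvd_mod_iff)
    then have "s g = 1" by (simp add: s_def)
    moreover have "(2 * g + r) mod 5 = t" using t(1) r unfolding g_def less_5_iff by auto
    ultimately have "conj_action g (K r) = H" using conj_action_K[OF r \<open>g < M\<close>] t by simp
    then show "H \<in> orbit G conj_action (K r)" using \<open>g < M\<close> by (auto simp: orbit_def)
  qed
qed

lemma card_classes: "num_subgroup_classes G = 2 * n + 2"
proof -
  have "subgroup_conjugacy_classes G = orbits G (subgroups_of G) conj_action"
    by (simp add: subgroup_conjugacy_classes_def conj_action_def [abs_def])
  also have "\<dots> = orbit G conj_action ` subgroups_of G" by (auto simp: orbits_def)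
  also have "\<dots> = (\<lambda>d. {multiples d}) ` D \<union> {K ` {..<5}}"
  proof -
    have "orbit G conj_action ` multiples ` D = (\<lambda>d. {multiples d}) ` D"
      unfolding image_image by (rule image_cong) (simp_all add: orbit_multiples)
    moreover have "orbit G conj_action ` K ` {..<5} = (\<lambda>r. K ` {..<5}) ` {..<5::nat}"
      unfolding image_image by (rule image_cong) (simp_all add: orbit_K)
    ultimately show ?thesis
      unfolding subgroups_eq image_Un by (simp add: image_constant_conv lessThan_empty_iff)
  qed
  finally have eq: "subgroup_conjugacy_classes G = insert (K ` {..<5}) ((\<lambda>d. {multiples d}) ` D)"
    by simp
  have "inj_on (\<lambda>d. {multiples d}) D" using inj_multiples by (auto simp: inj_on_def)
  moreover have "K ` {..<5} \<notin> (\<lambda>d. {multiples d}) ` D"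
  proof
    assume "K ` {..<5} \<in> (\<lambda>d. {multiples d}) ` D"
    then obtain d where d: "d \<in> D" "K ` {..<5} = {multiples d}" by blast
    moreover have "K 0 \<in> K ` {..<5}" by simp
    ultimately have "multiples d = K 0" by blast
    then show False using multiples_neq_K[OF d(1), of 0] by simp
  qed
  ultimately show ?thesis
    by (simp add: num_subgroup_classes_def eq finite_D card_image card_D)
qed

section \<open>The ratio and the choice of parameters\<close>

lemma ratio_G: "subgroup_class_ratio G = (real n + 1) / (real n + 3)"
proof -
  have "subgroup_class_ratio G = (2 * (real n + 1)) / (2 * (real n + 3))"
    by (simp add: subgroup_class_ratio_def card_classes card_subgroups)
  then show ?thesis by (simp only: mult_divide_mult_cancel_left)
qed

end

theorem corollary2p4:
  fixes a :: nat
  assumes "a \<ge> 1"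
  shows "\<exists>G :: nat monoid. group G \<and> finite (carrier G) \<and>
           subgroup_class_ratio G = real a / real (a + 1)"
proof -
  \<comment> \<open>Makes \<open>n + 1 = 2 * a\<close> and \<open>n + 3 = 2 * (a + 1)\<close>;
    \<open>n\<close> is positive because \<open>a\<close> is.\<close>
  define n where "n = 2 * a - 1"
  have "coprime (2 ^ n) (5::nat)" by simp
  then obtain c :: nat where c: "[c = 1] (mod 2 ^ n)" "[c = 4] (mod 5)"
    using binary_chinese_remainder_nat by blast
  interpret inversion_group n c
    using assms c by unfold_locales (auto simp: n_def)
  have "subgroup_class_ratio G = (2 * real a) / (2 * (real a + 1))"
    using ratio_G assms by (simp add: n_def of_nat_diff algebra_simps)
  then have "subgroup_class_ratio G = real a / (real a + 1)"
    by (simp only: mult_divide_mult_cancel_left)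
  then have "subgroup_class_ratio G = real a / real (a + 1)" by (simp add: add.commute)
  then show ?thesis using group_G by (intro exI[of _ G]) simp
qed

end
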